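(* Let $\mathcal{H}$ be a Hilbert space, let $S\in\mathfrak{Y}$, i.e. $S=P'Q'P'$ for some orthogonal projections $P',Q'\in L(\mathcal{H})$, and let $\mathfrak{Y}_S$ be the set of all pairs $(P,Q)$ of orthogonal projections in $L(\mathcal{H})$ with $S=PQP$. (1) If $R(S)$ is not closed, then $\|P-Q\|=1$ for every $(P,Q)\in\mathfrak{Y}_S$. (2) If $R(S)$ is closed, then for each pair $(P,Q)\in\mathfrak{Y}_S$, with $T=PQ$, the following alternative holds: either $T=PQ$ is not the canonical factorization of $T$, and then $\|P-Q\|=1$; or $P=P_{R(T)}$ and $Q=P_{N(T)^\perp}$, in which case $\|P_{R(T)}-P_{N(T)^\perp}\|$ is a constant $<1$ which is independent of the factorization $S=TT^*$; more precisely, $\|P_{R(T)}-P_{N(T)^\perp}\|=\|P_{R(S)}-S\|^{1/2}$.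
   Context: $L(\mathcal{H})$ is the algebra of bounded linear operators on $\mathcal{H}$; $R(\cdot)$ and $N(\cdot)$ denote range and nullspace. $P_{\mathcal{M}}$ is the orthogonal projection onto the closed subspace $\mathcal{M}$. If $T$ is a product of two orthogonal projections then $T=P_{\overline{R(T)}}P_{N(T)^\perp}$ (a known fact, due to Crimmins); this is called the canonical factorization of $T$. So "$T=PQ$ is the canonical factorization" means $P=P_{\overline{R(T)}}$ and $Q=P_{N(T)^\perp}$. When $R(S)$ is closed and $TT^*=S$, $R(T)$ is closed as well. *)

theory Defs
  imports "HOL-Analysis.Analysis"
begin

text \<open>
  Hilbert spaces are treated uniformly over the real and the complex numbers. A commutative normed
  real division algebra is \<open>\<real>\<close> or \<open>\<complex>\<close>, so up to isometric isomorphism the following class has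
  exactly these two instances; the last axiom determines the conjugation.
\<close>

class real_or_complex = real_normed_field +
  fixes conjugate :: "'a \<Rightarrow> 'a"
  assumes conjugate_add: "conjugate (x + y) = conjugate x + conjugate y"
    and mult_conjugate: "x * conjugate x = (norm x)\<^sup>2 *\<^sub>R 1"

instantiation real :: real_or_complex
begin
definition conjugate_real :: "real \<Rightarrow> real" where "conjugate_real x = x"
instance by standard (simp_all add: conjugate_real_def power2_eq_square)
end

instantiation complex :: real_or_complex
begin
definition conjugate_complex :: "complex \<Rightarrow> complex" where "conjugate_complex x = cnj x"
instance
  by standard
    (simp_all add: conjugate_complex_def scaleR_conv_of_real complex_norm_square[symmetric])
end

text \<open>
  The norm and the completeness of the carrier come from its type. By polarization \<open>norm_ip\<close> forces
  the real inner product \<open>inner\<close> of the type to be the real part of \<open>ip\<close>; conversely, every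
  Hilbert space over \<open>\<real>\<close> or \<open>\<complex>\<close> becomes a complete \<open>real_inner\<close> space with that real part.
\<close>

locale hilbert_space = vector_space sc
  for sc :: "'k::real_or_complex \<Rightarrow> 'a::{real_inner,complete_space} \<Rightarrow> 'a" +
  fixes ip :: "'a \<Rightarrow> 'a \<Rightarrow> 'k"
  assumes scale_of_real: "sc (of_real r) x = r *\<^sub>R x"
    and ip_add_left: "ip (x + y) z = ip x z + ip y z"
    and ip_scale_left: "ip (sc c x) y = c * ip x y"
    and ip_commute: "ip y x = conjugate (ip x y)"
    and norm_ip: "ip x x = of_real ((norm x)\<^sup>2)"

lemma hilbert_space_real:
  "hilbert_space scaleR (inner :: 'a::{real_inner,complete_space} \<Rightarrow> 'a \<Rightarrow> real)"
  by standard
    (auto simp: conjugate_real_def inner_add_left power2_norm_eq_inner scaleR_add_right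
      scaleR_add_left intro: inner_commute)

lemma hilbert_space_complex: "hilbert_space (*) (\<lambda>x y :: complex. x * cnj y)"
  by standard
    (simp_all add: conjugate_complex_def complex_norm_square[symmetric] algebra_simps
      scaleR_conv_of_real del: of_real_power)

text \<open>
  Elements of the type of bounded linear functions are only real linear. Their norm is the operator
  norm, which does not depend on the scalar field.
\<close>

definition bounded_operators ::
  "('k::real_or_complex \<Rightarrow> 'a::{real_inner,complete_space} \<Rightarrow> 'a) \<Rightarrow> ('a \<Rightarrow>\<^sub>L 'a) set"
  where "bounded_operators sc = {T. Vector_Spaces.linear sc sc (blinfun_apply T)}"

definition orth_projection ::
  "('k::real_or_complex \<Rightarrow> 'a::{real_inner,complete_space} \<Rightarrow> 'a) \<Rightarrow> ('a \<Rightarrow> 'a \<Rightarrow> 'k)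
    \<Rightarrow> ('a \<Rightarrow>\<^sub>L 'a) \<Rightarrow> bool"
  where "orth_projection sc ip P \<longleftrightarrow>
    P \<in> bounded_operators sc \<and> P o\<^sub>L P = P \<and> (\<forall>x y. ip (P x) y = ip x (P y))"

text \<open>Meaningful only for closed subspaces \<open>M\<close>.\<close>

definition proj_onto ::
  "('k::real_or_complex \<Rightarrow> 'a::{real_inner,complete_space} \<Rightarrow> 'a) \<Rightarrow> ('a \<Rightarrow> 'a \<Rightarrow> 'k)
    \<Rightarrow> 'a set \<Rightarrow> 'a \<Rightarrow>\<^sub>L 'a"
  where "proj_onto sc ip M =
    (THE P. orth_projection sc ip P \<and> range (blinfun_apply P) = M)"

definition nullspace :: "('a::real_normed_vector \<Rightarrow>\<^sub>L 'a) \<Rightarrow> 'a set"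
  where "nullspace T = {x. T x = 0}"

definition orth_compl :: "('a \<Rightarrow> 'a \<Rightarrow> 'k::zero) \<Rightarrow> 'a set \<Rightarrow> 'a set"
  where "orth_compl ip M = {x. \<forall>y\<in>M. ip x y = 0}"

definition canonical_factorization ::
  "('k::real_or_complex \<Rightarrow> 'a::{real_inner,complete_space} \<Rightarrow> 'a) \<Rightarrow> ('a \<Rightarrow> 'a \<Rightarrow> 'k)
    \<Rightarrow> ('a \<Rightarrow>\<^sub>L 'a) \<Rightarrow> ('a \<Rightarrow>\<^sub>L 'a) \<Rightarrow> ('a \<Rightarrow>\<^sub>L 'a) \<Rightarrow> bool"
  where "canonical_factorization sc ip T P Q \<longleftrightarrow>
    T = P o\<^sub>L Q \<and>
    P = proj_onto sc ip (closure (range (blinfun_apply T))) \<and>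
    Q = proj_onto sc ip (orth_compl ip (nullspace T))"

definition PQP_pairs ::
  "('k::real_or_complex \<Rightarrow> 'a::{real_inner,complete_space} \<Rightarrow> 'a) \<Rightarrow> ('a \<Rightarrow> 'a \<Rightarrow> 'k)
    \<Rightarrow> ('a \<Rightarrow>\<^sub>L 'a) \<Rightarrow> (('a \<Rightarrow>\<^sub>L 'a) \<times> ('a \<Rightarrow>\<^sub>L 'a)) set"
  where "PQP_pairs sc ip S =
    {(P, Q). orth_projection sc ip P \<and> orth_projection sc ip Q \<and> S = P o\<^sub>L Q o\<^sub>L P}"

definition PQP_operators ::
  "('k::real_or_complex \<Rightarrow> 'a::{real_inner,complete_space} \<Rightarrow> 'a) \<Rightarrow> ('a \<Rightarrow> 'a \<Rightarrow> 'k)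
    \<Rightarrow> ('a \<Rightarrow>\<^sub>L 'a) set"
  where "PQP_operators sc ip =
    {S. \<exists>P Q. orth_projection sc ip P \<and> orth_projection sc ip Q \<and> S = P o\<^sub>L Q o\<^sub>L P}"

end

theory Submission
  imports Defs
begin

text \<open>
  \<open>P - Q\<close> attains norm 1 as soon as \<open>R(P)\<close> meets \<open>N(Q)\<close> or \<open>R(Q)\<close> meets \<open>N(P)\<close> nontrivially, and
  the absence of both intersections is exactly canonicity of the factorization \<open>T = PQ\<close>.
  If \<open>\<parallel>P - Q\<parallel> < 1\<close>, then \<open>P - PQP = P(P - Q)P\<close> is a strict contraction, so \<open>PQP\<close> maps onto
  \<open>R(P)\<close> and has closed range. For a canonical factorization with closed \<open>R(S)\<close> one gets
  \<open>R(S) = R(P)\<close>, and \<open>P - S = P(1 - Q)P\<close> gives \<open>\<parallel>P - S\<parallel> = \<parallel>(1 - Q)P\<parallel>\<^sup>2\<close>. This is less than 1 because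
  the symmetric operator \<open>S\<close> is bounded below on its closed range. The bound
  \<open>\<parallel>Qx\<parallel> \<ge> a\<parallel>x\<parallel>\<close> on \<open>R(P)\<close> passes to \<open>\<parallel>Py\<parallel> \<ge> a\<parallel>y\<parallel>\<close> on the dense subspace \<open>R(QP)\<close> of
  \<open>R(Q)\<close>, so \<open>(1 - Q)P\<close> and \<open>(1 - P)Q\<close> are both bounded by \<open>\<parallel>P - S\<parallel>\<^sup>1\<^sup>/\<^sup>2\<close>, and so is \<open>P - Q\<close>.
\<close>

section \<open>Hilbert space preliminaries\<close>

text \<open>Uniform boundedness for the functionals \<open>inner u\<close>. The closed sets
  \<open>A n\<close> cover the space, so by Baire one of them contains a ball, and its radius
  controls every \<open>u\<close> at once.\<close>

lemma bounded_if_pointwise_bounded: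
  fixes U :: "'a::{real_inner,complete_space} set"
  assumes "\<And>z. \<exists>B. \<forall>u\<in>U. \<bar>inner u z\<bar> \<le> B"
  shows "bounded U"
proof -
  define A where "A n = {z. \<forall>u\<in>U. \<bar>inner u z\<bar> \<le> real n}" for n :: nat
  have closed_A: "closed (A n)" for n
  proof -
    have "A n = (\<Inter>u\<in>U. {z. \<bar>inner u z\<bar> \<le> real n})"
      by (auto simp: A_def)
    moreover have "closed {z. \<bar>inner u z\<bar> \<le> real n}" for u :: 'a
      by (intro closed_Collect_le continuous_intros)
    ultimately show ?thesis
      by auto
  qed
  have cover: "\<Union>(range A) = UNIV"
  proof -
    have "\<exists>n. z \<in> A n" for z
    proof -
      obtain B where B: "\<forall>u\<in>U. \<bar>inner u z\<bar> \<le> B"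
        using assms by blast
      obtain n :: nat where "B \<le> real n"
        using real_arch_simple by blast
      with B show ?thesis
        unfolding A_def using order_trans by blast
    qed
    then show ?thesis
      by auto
  qed
  have "\<exists>n. interior (A n) \<noteq> {}"
  proof (rule ccontr)
    assume no_interior: "\<nexists>n. interior (A n) \<noteq> {}"
    have "Met_TC.mtopology interior_of \<Union>(range A) = {}"
      by (rule Met_TC.metric_Baire_category_alt)
        (use no_interior closed_A in \<open>auto simp: complete_UNIV\<close>)
    with cover show False
      by simp
  qed
  then obtain n z where "z \<in> interior (A n)"
    by blast
  then obtain e where e: "e > 0" and ball: "cball z e \<subseteq> A n"
    by (meson interior_subset mem_interior_cball order_trans)
  have "norm u \<le> 2 * real n / e" if "u \<in> U" for u
  proof (cases "u = 0")
    case False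
    \<comment> \<open>\<open>h\<close> is the vector of length \<open>e\<close> in the direction of
      \<open>u\<close>. Both \<open>z\<close> and \<open>z + h\<close> lie in the ball, so the
      bounds there control \<open>inner u h\<close>, which is \<open>e * norm u\<close>.\<close>
    define h where "h = (e / norm u) *\<^sub>R u"
    have "norm h = e"
      using False e by (simp add: h_def)
    then have "z \<in> A n" "z + h \<in> A n"
      using ball e by (auto simp: subset_iff dist_norm)
    then have "\<bar>inner u (z + h)\<bar> \<le> real n" "\<bar>inner u z\<bar> \<le> real n"
      using that by (auto simp: A_def)
    then have "inner u h \<le> 2 * real n"
      by (simp add: inner_add_right)
    moreover have "inner u h = e * norm u"
      using False by (simp add: h_def power2_norm_eq_inner[symmetric] power2_eq_square)
    ultimately show ?thesis
      using e by (simp add: field_simps)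
  qed (use e in simp)
  then show ?thesis
    by (auto simp: bounded_iff)
qed

text \<open>The projection theorem: a minimizing sequence for the distance to \<open>M\<close> is
  Cauchy by the parallelogram law, and minimality of its limit forces orthogonality.\<close>

lemma orthogonal_point_in_closed_subspace:
  fixes M :: "'a::{real_inner,complete_space} set"
  assumes "subspace M" "closed M"
  obtains p where "p \<in> M" "\<And>m. m \<in> M \<Longrightarrow> inner (x - p) m = 0"
proof -
  define d where "d = infdist x M"
  have ne: "M \<noteq> {}"
    using assms(1) subspace_0 by blast
  have d_le: "d \<le> norm (x - m)" if "m \<in> M" for m
    using infdist_le[OF that, of x] by (simp add: d_def dist_norm)
  have d_nonneg: "0 \<le> d"
    by (simp add: d_def infdist_nonneg)
  have "\<exists>m\<in>M. (norm (x - m))\<^sup>2 < d\<^sup>2 + 1 / real (Suc n)" for n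
  proof -
    have "d < sqrt (d\<^sup>2 + 1 / real (Suc n))"
      by (rule real_less_rsqrt) simp
    then obtain m where m: "m \<in> M" "dist x m < sqrt (d\<^sup>2 + 1 / real (Suc n))"
      using ne by (auto simp: d_def infdist_notempty cINF_less_iff)
    then have "(norm (x - m))\<^sup>2 < (sqrt (d\<^sup>2 + 1 / real (Suc n)))\<^sup>2"
      by (intro power_strict_mono) (auto simp: dist_norm)
    also have "\<dots> = d\<^sup>2 + 1 / real (Suc n)"
      by (simp add: add_nonneg_nonneg)
    finally show ?thesis
      using m by blast
  qed
  then obtain s where s_M: "\<And>n. s n \<in> M"
    and s_less: "\<And>n. (norm (x - s n))\<^sup>2 < d\<^sup>2 + 1 / real (Suc n)"
    by metis
  have gap: "(norm (s i - s j))\<^sup>2 \<le> 2 / real (Suc i) + 2 / real (Suc j)" for i j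
  proof -
    have "(1/2) *\<^sub>R (s i + s j) \<in> M"
      using assms(1) s_M by (intro subspace_scale subspace_add)
    then have "d\<^sup>2 \<le> (norm (x - (1/2) *\<^sub>R (s i + s j)))\<^sup>2"
      using d_le d_nonneg by (intro power_mono)
    \<comment> \<open>Parallelogram law for \<open>x - s i\<close> and \<open>x - s j\<close>. The
      midpoint of \<open>s i\<close> and \<open>s j\<close> is in \<open>M\<close>, so the
      \<open>d\<close> terms cancel and only the slacks remain.\<close>
    moreover have "(norm (s i - s j))\<^sup>2 + 4 * (norm (x - (1/2) *\<^sub>R (s i + s j)))\<^sup>2
        = 2 * (norm (x - s i))\<^sup>2 + 2 * (norm (x - s j))\<^sup>2"
      by (simp add: power2_norm_eq_inner algebra_simps inner_commute)
    ultimately show ?thesis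
      using s_less[of i] s_less[of j] by simp
  qed
  have "Cauchy s"
  proof (rule metric_CauchyI)
    fix e :: real
    assume "e > 0"
    then obtain N :: nat where N: "4 / e\<^sup>2 < real N"
      using reals_Archimedean2 by blast
    then have N_pos: "0 < real N"
      using \<open>e > 0\<close> by (smt (verit) divide_nonneg_nonneg zero_le_power2)
    have "dist (s i) (s j) < e" if "N \<le> i" "N \<le> j" for i j
    proof -
      have "2 / real (Suc i) \<le> 2 / real N" "2 / real (Suc j) \<le> 2 / real N"
        using that N_pos by (auto intro!: divide_left_mono)
      then have "(norm (s i - s j))\<^sup>2 \<le> 4 / real N"
        using gap[of i j] by linarith
      also have "\<dots> < e\<^sup>2"
        using N N_pos \<open>e > 0\<close> by (simp add: field_simps)
      finally show ?thesis
        using \<open>e > 0\<close> by (simp add: dist_norm power_less_imp_less_base)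
    qed
    then show "\<exists>N. \<forall>i\<ge>N. \<forall>j\<ge>N. dist (s i) (s j) < e"
      by blast
  qed
  then obtain p where p: "s \<longlonglongrightarrow> p"
    using Cauchy_convergent convergent_def by blast
  have "p \<in> M"
    using assms(2) s_M p closed_sequentially by blast
  moreover have "inner (x - p) m = 0" if "m \<in> M" for m
  proof (cases "m = 0")
    case False
    have "(\<lambda>n. (norm (x - s n))\<^sup>2) \<longlonglongrightarrow> (norm (x - p))\<^sup>2"
      by (intro tendsto_intros p)
    moreover have "(\<lambda>n. d\<^sup>2 + 1 / real (Suc n)) \<longlonglongrightarrow> d\<^sup>2 + 0"
      by (intro tendsto_intros LIMSEQ_Suc lim_1_over_n)
    ultimately have p_le: "(norm (x - p))\<^sup>2 \<le> d\<^sup>2"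
      using s_less by (intro LIMSEQ_le) (auto intro: less_imp_le)
    \<comment> \<open>This \<open>t\<close> minimizes the distance from \<open>x\<close> along the
      line through \<open>p\<close> in direction \<open>m\<close>. Moving there would gain exactly
      the square of \<open>inner (x - p) m\<close> over that of \<open>norm m\<close>.\<close>
    define t where "t = inner (x - p) m / (norm m)\<^sup>2"
    have "p + t *\<^sub>R m \<in> M"
      using assms(1) that \<open>p \<in> M\<close> by (intro subspace_add subspace_scale)
    then have "d\<^sup>2 \<le> (norm (x - (p + t *\<^sub>R m)))\<^sup>2"
      using d_le d_nonneg by (intro power_mono)
    also have "\<dots> = (norm (x - p))\<^sup>2 - 2 * t * inner (x - p) m + t\<^sup>2 * (norm m)\<^sup>2"
      unfolding power2_norm_eq_inner by (simp add: algebra_simps inner_commute power2_eq_square)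
    also have "\<dots> = (norm (x - p))\<^sup>2 - (inner (x - p) m)\<^sup>2 / (norm m)\<^sup>2"
      using False by (simp add: t_def power2_eq_square field_simps)
    finally have "(inner (x - p) m)\<^sup>2 / (norm m)\<^sup>2 \<le> 0"
      using p_le by linarith
    then show ?thesis
      using False by (simp add: divide_le_0_iff)
  qed simp
  ultimately show ?thesis
    using that by blast
qed

section \<open>Symmetric idempotents for the real inner product\<close>

text \<open>Orthogonal projections seen through the real inner product alone, so that the norm
  estimates can be made without reference to the scalar field.\<close>

definition symmetric_projection :: "('a::real_inner \<Rightarrow>\<^sub>L 'a) \<Rightarrow> bool"
  where "symmetric_projection P \<longleftrightarrow>
    (\<forall>x. P (P x) = P x) \<and> (\<forall>x y. inner (P x) y = inner x (P y))"

lemma symmetric_projection_idem: "symmetric_projection P \<Longrightarrow> P (P x) = P x"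
  by (simp add: symmetric_projection_def)

lemma symmetric_projection_sym: "symmetric_projection P \<Longrightarrow> inner (P x) y = inner x (P y)"
  by (simp add: symmetric_projection_def)

lemma in_range_symmetric_projection_iff:
  "symmetric_projection P \<Longrightarrow> x \<in> range (blinfun_apply P) \<longleftrightarrow> P x = x"
  by (metis rangeE rangeI symmetric_projection_idem)

lemma symmetric_projection_complement:
  "symmetric_projection P \<Longrightarrow> symmetric_projection (id_blinfun - P)"
  by (simp add: symmetric_projection_def blinfun.diff_left blinfun.diff_right inner_diff_left
      inner_diff_right)

lemma symmetric_projection_pythagoras:
  assumes "symmetric_projection P"
  shows "(norm x)\<^sup>2 = (norm (P x))\<^sup>2 + (norm (x - P x))\<^sup>2"
proof -
  have "inner (P x) (x - P x) = 0"
    using assms by (simp add: symmetric_projection_def inner_diff_right)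
  then show ?thesis
    using norm_add_Pythagorean[of "P x" "x - P x"] by (simp add: orthogonal_def)
qed

lemma norm_symmetric_projection_sq:
  "symmetric_projection P \<Longrightarrow> (norm (P x))\<^sup>2 = inner (P x) x"
  by (metis power2_norm_eq_inner symmetric_projection_def)

lemma norm_symmetric_projection_le:
  assumes "symmetric_projection P"
  shows "norm (P x) \<le> norm x"
  by (rule power2_le_imp_le) (simp_all add: symmetric_projection_pythagoras[OF assms, of x])

lemma symmetric_projection_eqI:
  assumes P: "symmetric_projection P" and Q: "symmetric_projection Q"
    and range_eq: "range (blinfun_apply P) = range (blinfun_apply Q)"
  shows "P = Q"
proof (rule blinfun_eqI)
  fix x
  have PQ: "P (Q x) = Q x"
    using P range_eq in_range_symmetric_projection_iff[of P] by blast
  have QP: "Q (P x) = P x"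
    using Q range_eq in_range_symmetric_projection_iff[of Q] by blast
  \<comment> \<open>By symmetry, \<open>PQ = Q\<close> and \<open>QP = P\<close>, the four terms are
    \<open>inner x (P x)\<close> and \<open>inner x (Q x)\<close>, each once with either
    sign.\<close>
  have "inner (P x - Q x) (P x - Q x) = 0"
    using P Q PQ QP
    by (simp add: inner_diff_left inner_diff_right symmetric_projection_sym[OF P]
        symmetric_projection_sym[OF Q] symmetric_projection_idem)
  then show "P x = Q x"
    by simp
qed

lemma symmetric_projection_onto_exists:
  fixes M :: "'a::{real_inner,complete_space} set"
  assumes "subspace M" "closed M"
  obtains P where "symmetric_projection P" "range (blinfun_apply P) = M"
proof -
  have "\<forall>x. \<exists>p. p \<in> M \<and> (\<forall>m\<in>M. inner (x - p) m = 0)"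
    using orthogonal_point_in_closed_subspace[OF assms] by metis
  then obtain f where f_M: "f x \<in> M" and f_orth: "m \<in> M \<Longrightarrow> inner (x - f x) m = 0" for x m
    by metis
  \<comment> \<open>The orthogonal decomposition is unique; additivity, homogeneity and the fixing
    of \<open>M\<close> all follow by checking that the candidate value qualifies.\<close>
  have f_unique: "f x = p" if "p \<in> M" "\<And>m. m \<in> M \<Longrightarrow> inner (x - p) m = 0" for x p
  proof -
    have "f x - p \<in> M"
      using assms(1) f_M that(1) by (intro subspace_diff)
    then have "inner (x - p) (f x - p) - inner (x - f x) (f x - p) = 0"
      using that(2) f_orth by simp
    then show ?thesis
      by (simp add: inner_diff_left[symmetric])
  qed
  have "f (x + y) = f x + f y" for x y
  proof (rule f_unique)
    show "inner (x + y - (f x + f y)) m = 0" if "m \<in> M" for m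
      using f_orth[OF that, of x] f_orth[OF that, of y]
      by (simp add: inner_diff_left inner_add_left)
  qed (use f_M assms(1) in \<open>auto intro: subspace_add\<close>)
  moreover have "f (r *\<^sub>R x) = r *\<^sub>R f x" for r x
  proof (rule f_unique)
    show "inner (r *\<^sub>R x - r *\<^sub>R f x) m = 0" if "m \<in> M" for m
      using f_orth[OF that, of x] by (simp add: inner_diff_left)
  qed (use f_M assms(1) in \<open>auto intro: subspace_scale\<close>)
  moreover have "norm (f x) \<le> norm x * 1" for x
  proof (rule power2_le_imp_le)
    have "(norm (x - f x + f x))\<^sup>2 = (norm (x - f x))\<^sup>2 + (norm (f x))\<^sup>2"
      using f_orth f_M by (intro norm_add_Pythagorean) (simp add: orthogonal_def)
    then show "(norm (f x))\<^sup>2 \<le> (norm x * 1)\<^sup>2"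
      by simp
  qed simp
  ultimately have "bounded_linear f"
    by (rule bounded_linear_intro)
  then have apply_f: "blinfun_apply (Blinfun f) = f"
    by (simp add: bounded_linear_Blinfun_apply)
  have f_fix: "f x = x" if "x \<in> M" for x
    using that by (intro f_unique) auto
  have "inner (f x) y = inner x (f y)" for x y
    using f_orth[OF f_M, of x y] f_orth[OF f_M, of y x]
    by (simp add: inner_diff_left inner_commute[of "f x" y] inner_commute[of "f y" "f x"])
  then have "symmetric_projection (Blinfun f)"
    unfolding symmetric_projection_def apply_f using f_fix f_M by blast
  moreover have "range f = M"
    using f_fix f_M by (metis rangeI image_subsetI subsetI subset_antisym)
  ultimately show ?thesis
    using that apply_f by metis
qed

section \<open>Closures of ranges and lower bounds on closed ranges\<close>

lemma subspace_closure:
  fixes M :: "'a::real_normed_vector set"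
  assumes "subspace M"
  shows "subspace (closure M)"
proof (rule subspaceI)
  show "0 \<in> closure M"
    using assms subspace_0 closure_subset by blast
  show "x + y \<in> closure M" if x: "x \<in> closure M" and y: "y \<in> closure M" for x y
  proof -
    obtain f where f: "\<And>n. f n \<in> M" "f \<longlonglongrightarrow> x"
      using x unfolding closure_sequential by blast
    obtain g where g: "\<And>n. g n \<in> M" "g \<longlonglongrightarrow> y"
      using y unfolding closure_sequential by blast
    have "\<forall>n. f n + g n \<in> M"
      using f(1) g(1) assms subspace_add by blast
    moreover have "(\<lambda>n. f n + g n) \<longlonglongrightarrow> x + y"
      using f(2) g(2) by (rule tendsto_add)
    ultimately show ?thesis
      unfolding closure_sequential by (intro exI[of _ "\<lambda>n. f n + g n"] conjI)
  qed
  show "c *\<^sub>R x \<in> closure M" if "x \<in> closure M" for c x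
  proof -
    have "c *\<^sub>R x \<in> closure ((*\<^sub>R) c ` M)"
      using that closure_scaleR[of c M] by blast
    also have "\<dots> \<subseteq> closure M"
      using subspace_scale[OF assms] by (intro closure_mono) blast
    finally show ?thesis .
  qed
qed

text \<open>A density criterion, applied below to \<open>PQP\<close>, \<open>QP\<close> and
  \<open>PQ\<close>. With \<open>P\<close> the projection onto the closure of the range of
  \<open>A\<close>, a vector \<open>y\<close> of the range of \<open>Q\<close> leaves a remainder
  \<open>y - P y\<close> orthogonal to the range of \<open>A\<close>, which \<open>total\<close>
  makes zero.\<close>

lemma closure_range_eq_range_projection:
  fixes A Q :: "'a::{real_inner,complete_space} \<Rightarrow>\<^sub>L 'a"
  assumes Q: "symmetric_projection Q"
    and range_le: "\<And>x. Q (A x) = A x"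
    and total: "\<And>y. Q y = y \<Longrightarrow> (\<And>x. inner y (A x) = 0) \<Longrightarrow> y = 0"
  shows "closure (range (blinfun_apply A)) = range (blinfun_apply Q)"
proof -
  have subspace_A: "subspace (closure (range (blinfun_apply A)))"
    by (intro subspace_closure linear_subspace_image subspace_UNIV
        bounded_linear.linear[OF blinfun.bounded_linear_right])
  then obtain P where P: "symmetric_projection P"
    and range_P: "range (blinfun_apply P) = closure (range (blinfun_apply A))"
    using symmetric_projection_onto_exists closed_closure by blast
  have PA: "P (A x) = A x" for x
  proof -
    have "A x \<in> range (blinfun_apply P)"
      unfolding range_P by (rule subsetD[OF closure_subset rangeI])
    then show ?thesis
      by (simp add: in_range_symmetric_projection_iff[OF P])
  qed
  have "closed {y. Q y = y}"
    by (intro closed_Collect_eq continuous_intros)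
  then have "closure (range (blinfun_apply A)) \<subseteq> {y. Q y = y}"
    using range_le by (intro closure_minimal) auto
  then have QP: "Q (P x) = P x" for x
    using range_P by blast
  have "P y = y" if "Q y = y" for y
  proof -
    have "y - P y = 0"
    proof (rule total)
      show "Q (y - P y) = y - P y"
        using that QP by (simp add: blinfun.diff_right)
      show "inner (y - P y) (A x) = 0" for x
        using PA by (simp add: inner_diff_left symmetric_projection_sym[OF P])
    qed
    then show ?thesis
      by simp
  qed
  moreover have "Q y = y" if "P y = y" for y
    using QP[of y] that by simp
  ultimately have "range (blinfun_apply P) = range (blinfun_apply Q)"
    by (intro set_eqI) (metis in_range_symmetric_projection_iff[OF P]
        in_range_symmetric_projection_iff[OF Q])
  then show ?thesis
    using range_P by simp
qed

text \<open>Uniform boundedness acts as a bounded inverse theorem here. If \<open>S w\<close> is the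
  projection of \<open>z\<close> onto the closed range, then
  \<open>inner u z = inner (S u) w\<close> for \<open>u\<close> in the range, so the set of those
  \<open>u\<close> with \<open>norm (S u) \<le> 1\<close> is pointwise bounded.\<close>

lemma symmetric_operator_bounded_below_on_closed_range:
  fixes S :: "'a::{real_inner,complete_space} \<Rightarrow>\<^sub>L 'a"
  assumes sym: "\<And>x y. inner (S x) y = inner x (S y)"
    and closed: "closed (range (blinfun_apply S))"
  obtains d where "d > 0" "\<And>x. x \<in> range (blinfun_apply S) \<Longrightarrow> d * norm x \<le> norm (S x)"
proof -
  define U where "U = {u \<in> range (blinfun_apply S). norm (S u) \<le> 1}"
  have subspace_S: "subspace (range (blinfun_apply S))"
    by (intro linear_subspace_image subspace_UNIV
        bounded_linear.linear[OF blinfun.bounded_linear_right])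
  have "bounded U"
  proof (rule bounded_if_pointwise_bounded)
    fix z
    obtain p where p: "p \<in> range (blinfun_apply S)"
      and orth: "\<And>m. m \<in> range (blinfun_apply S) \<Longrightarrow> inner (z - p) m = 0"
      using orthogonal_point_in_closed_subspace[OF subspace_S closed] by blast
    obtain w where w: "p = S w"
      using p by blast
    have "\<bar>inner u z\<bar> \<le> norm w" if "u \<in> U" for u
    proof -
      have "inner u z = inner u p"
        using that orth[of u] by (simp add: U_def inner_commute[of "z - p"] inner_diff_right)
      also have "\<dots> = inner (S u) w"
        by (simp add: w sym)
      finally have "\<bar>inner u z\<bar> \<le> norm (S u) * norm w"
        by (simp add: Cauchy_Schwarz_ineq2)
      also have "\<dots> \<le> 1 * norm w"
        using that by (intro mult_right_mono) (auto simp: U_def)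
      finally show ?thesis
        by simp
    qed
    then show "\<exists>B. \<forall>u\<in>U. \<bar>inner u z\<bar> \<le> B"
      by blast
  qed
  then obtain B where B: "B > 0" "\<And>u. u \<in> U \<Longrightarrow> norm u \<le> B"
    by (meson bounded_pos)
  have "(1 / B) * norm x \<le> norm (S x)" if x: "x \<in> range (blinfun_apply S)" for x
  proof (cases "S x = 0")
    case True
    \<comment> \<open>A symmetric operator is injective on its range, so the normalization by
      \<open>norm (S x)\<close> below only has to treat nonzero values.\<close>
    have "(norm x)\<^sup>2 = 0"
    proof -
      obtain w where "x = S w"
        using x by blast
      then have "inner x x = inner (S x) w"
        by (metis sym)
      then show ?thesis
        using True by (simp add: power2_norm_eq_inner)
    qed
    then show ?thesis
      by simp
  next
    case False
    have "(1 / norm (S x)) *\<^sub>R x \<in> U"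
      using x False subspace_scale[OF subspace_S x] by (simp add: U_def blinfun.scaleR_right)
    then have "norm ((1 / norm (S x)) *\<^sub>R x) \<le> B"
      by (rule B)
    then show ?thesis
      using False B(1) by (simp add: field_simps)
  qed
  with B(1) show ?thesis
    by (intro that[of "1 / B"]) auto
qed

section \<open>Norms of differences and compressions of projections\<close>

text \<open>Split \<open>z\<close> into \<open>Q z\<close> and \<open>w = z - Q z\<close>. The
  images \<open>P w\<close> and \<open>Q z - P (Q z)\<close> lie in the range and the nullspace of
  \<open>P\<close>, so Pythagoras applies both to them and to the splitting of
  \<open>z\<close>.\<close>

lemma norm_projection_diff_le:
  assumes P: "symmetric_projection P" and Q: "symmetric_projection Q" and b: "0 \<le> b"
    and on_P: "\<And>x. P x = x \<Longrightarrow> norm (x - Q x) \<le> b * norm x"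
    and on_Q: "\<And>y. Q y = y \<Longrightarrow> norm (y - P y) \<le> b * norm y"
  shows "norm (P - Q) \<le> b"
proof (rule norm_blinfun_bound[OF b])
  fix z
  define w where "w = z - Q z"
  have Qw: "Q w = 0"
    using Q by (simp add: w_def blinfun.diff_right symmetric_projection_idem)
  \<comment> \<open>A duality argument: \<open>on_P\<close> bounds \<open>(1 - Q)P\<close>, while
    \<open>P w\<close> requires a bound for its adjoint \<open>P(1 - Q)\<close>. Since
    \<open>Q w = 0\<close>, the term \<open>Q (P w)\<close> can be subtracted freely.\<close>
  have "norm (P w) * norm (P w) = inner (P w - Q (P w)) w"
    using norm_symmetric_projection_sq[OF P, of w] Qw symmetric_projection_sym[OF Q, of "P w" w]
    by (simp add: power2_eq_square inner_diff_left)
  also have "\<dots> \<le> norm (P w - Q (P w)) * norm w"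
    by (rule norm_cauchy_schwarz)
  also have "\<dots> \<le> b * norm (P w) * norm w"
    using on_P[of "P w"] P by (intro mult_right_mono) (auto simp: symmetric_projection_idem)
  finally have "norm (P w) * norm (P w) \<le> norm (P w) * (b * norm w)"
    by (simp add: mult_ac)
  then have Pw: "norm (P w) \<le> b * norm w"
    using b by (cases "P w = 0") (auto simp: mult_le_cancel_left)
  have PQz: "norm (Q z - P (Q z)) \<le> b * norm (Q z)"
    using on_Q Q by (simp add: symmetric_projection_idem)
  have "(P - Q) z = P w + - (Q z - P (Q z))"
    by (simp add: w_def blinfun.diff_left blinfun.diff_right)
  moreover have "orthogonal (P w) (- (Q z - P (Q z)))"
    using P by (simp add: orthogonal_def inner_diff_right symmetric_projection_sym
        symmetric_projection_idem)
  ultimately have "(norm ((P - Q) z))\<^sup>2 = (norm (P w))\<^sup>2 + (norm (Q z - P (Q z)))\<^sup>2"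
    by (simp only: norm_add_Pythagorean norm_minus_cancel)
  also have "\<dots> \<le> (b * norm w)\<^sup>2 + (b * norm (Q z))\<^sup>2"
    using Pw PQz by (intro add_mono power_mono) auto
  also have "\<dots> = (b * norm z)\<^sup>2"
    unfolding power_mult_distrib symmetric_projection_pythagoras[OF Q, of z] w_def
    by (simp add: algebra_simps)
  finally show "norm ((P - Q) z) \<le> b * norm z"
    by (rule power2_le_imp_le) (use b in simp)
qed

lemma norm_projection_diff_le_1:
  assumes "symmetric_projection P" "symmetric_projection Q"
  shows "norm (P - Q) \<le> 1"
proof -
  have "norm (x - R x) \<le> 1 * norm x" if "symmetric_projection R" for R :: "'a \<Rightarrow>\<^sub>L 'a" and x
    using norm_symmetric_projection_le[OF symmetric_projection_complement[OF that], of x]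
    by (simp add: blinfun.diff_left)
  with assms show ?thesis
    by (intro norm_projection_diff_le) auto
qed

lemma norm_projection_diff_eq_1:
  assumes "symmetric_projection P" "symmetric_projection Q"
    and "P x = x" "Q x = 0" "x \<noteq> 0"
  shows "norm (P - Q) = 1"
proof -
  have "norm x \<le> norm (P - Q) * norm x"
    using norm_blinfun[of "P - Q" x] assms by (simp add: blinfun.diff_left)
  with \<open>x \<noteq> 0\<close> have "1 \<le> norm (P - Q)"
    by simp
  with norm_projection_diff_le_1[OF assms(1,2)] show ?thesis
    by simp
qed

lemma range_PQP_if_norm_diff_less_1:
  fixes P Q :: "'a::{real_inner,complete_space} \<Rightarrow>\<^sub>L 'a"
  assumes P: "symmetric_projection P" and Q: "symmetric_projection Q" and less: "norm (P - Q) < 1"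
  shows "range (blinfun_apply (P o\<^sub>L Q o\<^sub>L P)) = range (blinfun_apply P)"
proof (intro subset_antisym subsetI)
  fix y
  assume "y \<in> range (blinfun_apply P)"
  then have y: "P y = y"
    using in_range_symmetric_projection_iff[OF P] by blast
  \<comment> \<open>A fixed point of \<open>f\<close> lies in the range of \<open>P\<close> because
    all values of \<open>f\<close> do, and there \<open>f x = x\<close> reads
    \<open>P (Q (P x)) = y\<close>. The contraction constant comes from
    \<open>P - PQP = P(P - Q)P\<close>.\<close>
  define f where "f x = y + (P x - P (Q (P x)))" for x
  have "dist (f x) (f z) \<le> norm (P - Q) * dist x z" for x z
  proof -
    have "f x - f z = P ((P - Q) (P (x - z)))"
      using P by (simp add: f_def blinfun.diff_left blinfun.diff_right symmetric_projection_idem)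
    then have "dist (f x) (f z) \<le> norm ((P - Q) (P (x - z)))"
      using norm_symmetric_projection_le[OF P] by (simp add: dist_norm)
    also have "\<dots> \<le> norm (P - Q) * norm (P (x - z))"
      by (rule norm_blinfun)
    also have "\<dots> \<le> norm (P - Q) * norm (x - z)"
      using norm_symmetric_projection_le[OF P] by (intro mult_left_mono) auto
    finally show ?thesis
      by (simp add: dist_norm)
  qed
  then obtain x where x: "f x = x"
    using banach_fix_type[of "norm (P - Q)" f] less by auto
  have "P x = P (f x)"
    by (simp add: x)
  also have "\<dots> = f x"
    using P y by (simp add: f_def blinfun.add_right blinfun.diff_right symmetric_projection_idem)
  finally have "P x = x"
    by (simp add: x)
  with x have "(P o\<^sub>L Q o\<^sub>L P) x = y"
    by (simp add: f_def algebra_simps)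
  then show "y \<in> range (blinfun_apply (P o\<^sub>L Q o\<^sub>L P))"
    by blast
qed auto

text \<open>The C*-identity for \<open>A = RP\<close>: the adjoint of \<open>A\<close> is
  \<open>PR\<close>, and \<open>R\<close> is idempotent, so its product with \<open>A\<close> is
  \<open>PRP\<close>.\<close>

lemma norm_compression:
  assumes P: "symmetric_projection P" and R: "symmetric_projection R"
  shows "norm (P o\<^sub>L R o\<^sub>L P) = (norm (R o\<^sub>L P))\<^sup>2"
proof (rule antisym)
  show "norm (P o\<^sub>L R o\<^sub>L P) \<le> (norm (R o\<^sub>L P))\<^sup>2"
  proof (rule norm_blinfun_bound)
    fix x
    define y where "y = P (R (P x))"
    have "norm y * norm y = inner (R (P x)) (R (P y))"
    proof -
      have "norm y * norm y = inner (P (R (P x))) y"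
        by (simp add: y_def power2_eq_square[symmetric] power2_norm_eq_inner)
      also have "\<dots> = inner (R (R (P x))) (P y)"
        by (simp only: symmetric_projection_sym[OF P] symmetric_projection_idem[OF R])
      also have "\<dots> = inner (R (P x)) (R (P y))"
        by (rule symmetric_projection_sym[OF R])
      finally show ?thesis .
    qed
    also have "\<dots> \<le> norm ((R o\<^sub>L P) x) * norm ((R o\<^sub>L P) y)"
      using norm_cauchy_schwarz by simp
    also have "\<dots> \<le> (norm (R o\<^sub>L P) * norm x) * (norm (R o\<^sub>L P) * norm y)"
      by (intro mult_mono norm_blinfun) auto
    finally have "norm y * norm y \<le> norm y * ((norm (R o\<^sub>L P))\<^sup>2 * norm x)"
      by (simp add: power2_eq_square mult_ac)
    then have "norm y \<le> (norm (R o\<^sub>L P))\<^sup>2 * norm x"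
      by (cases "y = 0") (auto simp: mult_le_cancel_left)
    then show "norm ((P o\<^sub>L R o\<^sub>L P) x) \<le> (norm (R o\<^sub>L P))\<^sup>2 * norm x"
      by (simp add: y_def)
  qed simp
next
  have "norm (R o\<^sub>L P) \<le> sqrt (norm (P o\<^sub>L R o\<^sub>L P))"
  proof (rule norm_blinfun_bound)
    fix x
    have "(norm ((R o\<^sub>L P) x))\<^sup>2 = inner ((P o\<^sub>L R o\<^sub>L P) x) x"
      using norm_symmetric_projection_sq[OF R, of "P x"] symmetric_projection_sym[OF P] by simp
    also have "\<dots> \<le> norm ((P o\<^sub>L R o\<^sub>L P) x) * norm x"
      by (rule norm_cauchy_schwarz)
    also have "\<dots> \<le> norm (P o\<^sub>L R o\<^sub>L P) * norm x * norm x"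
      by (intro mult_right_mono norm_blinfun) auto
    also have "\<dots> = (sqrt (norm (P o\<^sub>L R o\<^sub>L P)) * norm x)\<^sup>2"
      by (simp add: power_mult_distrib power2_eq_square)
    finally show "norm ((R o\<^sub>L P) x) \<le> sqrt (norm (P o\<^sub>L R o\<^sub>L P)) * norm x"
      by (rule power2_le_imp_le) simp
  qed simp
  then show "(norm (R o\<^sub>L P))\<^sup>2 \<le> norm (P o\<^sub>L R o\<^sub>L P)"
    by (metis norm_ge_zero power_mono real_sqrt_pow2)
qed

lemma norm_projection_minus_compression:
  assumes P: "symmetric_projection P" and Q: "symmetric_projection Q"
  shows "norm (P - (P o\<^sub>L Q o\<^sub>L P)) = (norm ((id_blinfun - Q) o\<^sub>L P))\<^sup>2"
proof -
  have "P - (P o\<^sub>L Q o\<^sub>L P) = P o\<^sub>L (id_blinfun - Q) o\<^sub>L P"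
    using P by (intro blinfun_eqI)
      (simp add: blinfun.diff_left blinfun.diff_right symmetric_projection_idem)
  then show ?thesis
    using norm_compression[OF P symmetric_projection_complement[OF Q]] by simp
qed

lemma norm_projection_diff_eq:
  fixes P Q :: "'a::{real_inner,complete_space} \<Rightarrow>\<^sub>L 'a"
  assumes P: "symmetric_projection P" and Q: "symmetric_projection Q"
    and inj: "\<And>y. Q y = y \<Longrightarrow> P y = 0 \<Longrightarrow> y = 0"
    and less: "norm (P - (P o\<^sub>L Q o\<^sub>L P)) < 1"
  shows "norm (P - Q) = sqrt (norm (P - (P o\<^sub>L Q o\<^sub>L P)))"
proof -
  \<comment> \<open>\<open>b\<close> and \<open>a\<close> are the sine and cosine of the largest
    angle that a vector of the range of \<open>P\<close> makes with the range of
    \<open>Q\<close>.\<close>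
  define b where "b = norm ((id_blinfun - Q) o\<^sub>L P)"
  define a where "a = sqrt (1 - b\<^sup>2)"
  have norm_S: "norm (P - (P o\<^sub>L Q o\<^sub>L P)) = b\<^sup>2"
    using norm_projection_minus_compression[OF P Q] by (simp add: b_def)
  have b: "0 \<le> b"
    by (simp add: b_def)
  have a: "0 < a" "a\<^sup>2 = 1 - b\<^sup>2"
    using less by (simp_all add: a_def norm_S)
  have on_P: "norm (x - Q x) \<le> b * norm x" if "P x = x" for x
    using norm_blinfun[of "(id_blinfun - Q) o\<^sub>L P" x] that by (simp add: b_def blinfun.diff_left)
  have lower_P: "a * norm x \<le> norm (Q x)" if "P x = x" for x
  proof (rule power2_le_imp_le)
    have "(norm (x - Q x))\<^sup>2 \<le> (b * norm x)\<^sup>2"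
      using on_P[OF that] by (intro power_mono) auto
    then show "(a * norm x)\<^sup>2 \<le> (norm (Q x))\<^sup>2"
      using symmetric_projection_pythagoras[OF Q, of x]
      unfolding power_mult_distrib a(2) left_diff_distrib by linarith
  qed simp
  \<comment> \<open>Being closed, \<open>C\<close> contains the closure of any set it contains; the
    bound proved on the range of \<open>QP\<close> thus reaches all of the range of
    \<open>Q\<close>.\<close>
  define C where "C = {y. a * norm y \<le> norm (P y)}"
  have "closed C"
    unfolding C_def by (intro closed_Collect_le continuous_intros)
  have QP_C: "Q (P x) \<in> C" for x
  proof -
    define u where "u = P x"
    have Pu: "P u = u"
      using P by (simp add: u_def symmetric_projection_idem)
    have "norm (Q u) * norm (Q u) = inner (P (Q u)) u"
      using norm_symmetric_projection_sq[OF Q, of u] symmetric_projection_sym[OF P, of "Q u" u] Pu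
      by (simp add: power2_eq_square)
    also have "\<dots> \<le> norm (P (Q u)) * norm u"
      by (rule norm_cauchy_schwarz)
    \<comment> \<open>Cauchy-Schwarz leaves a factor \<open>norm u\<close>; \<open>lower_P\<close>
      trades \<open>a * norm u\<close> for \<open>norm (Q u)\<close>, which then cancels.\<close>
    finally have "a * (norm (Q u) * norm (Q u)) \<le> norm (P (Q u)) * (a * norm u)"
      using a(1) by (simp add: mult_ac)
    also have "\<dots> \<le> norm (P (Q u)) * norm (Q u)"
      using lower_P[OF Pu] by (intro mult_left_mono) auto
    finally have "norm (Q u) * (a * norm (Q u)) \<le> norm (Q u) * norm (P (Q u))"
      by (simp add: mult_ac)
    then have "a * norm (Q u) \<le> norm (P (Q u))"
      by (cases "Q u = 0") (auto simp: mult_le_cancel_left)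
    then show ?thesis
      by (simp add: C_def u_def)
  qed
  have "closure (range (blinfun_apply (Q o\<^sub>L P))) = range (blinfun_apply Q)"
  proof (rule closure_range_eq_range_projection[OF Q])
    fix y
    assume y: "Q y = y" and orth: "\<And>x. inner y ((Q o\<^sub>L P) x) = 0"
    \<comment> \<open>Vectors of the range of \<open>Q\<close> orthogonal to the range of
      \<open>QP\<close> are killed by \<open>P\<close>, so \<open>inj\<close> is exactly
      density.\<close>
    have "inner (P y) (P y) = inner y ((Q o\<^sub>L P) y)"
      using symmetric_projection_sym[OF P] symmetric_projection_sym[OF Q, of y "P y"] y
        symmetric_projection_idem[OF P] by simp
    then have "P y = 0"
      using orth by simp
    with y show "y = 0"
      by (rule inj)
  qed (simp add: symmetric_projection_idem[OF Q])
  moreover have "closure (range (blinfun_apply (Q o\<^sub>L P))) \<subseteq> C"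
    using QP_C \<open>closed C\<close> by (intro closure_minimal) auto
  ultimately have lower_Q: "a * norm y \<le> norm (P y)" if "Q y = y" for y
    using that in_range_symmetric_projection_iff[OF Q] by (auto simp: C_def)
  have on_Q: "norm (y - P y) \<le> b * norm y" if "Q y = y" for y
  proof (rule power2_le_imp_le)
    have "(a * norm y)\<^sup>2 \<le> (norm (P y))\<^sup>2"
      using lower_Q[OF that] a(1) by (intro power_mono) auto
    then show "(norm (y - P y))\<^sup>2 \<le> (b * norm y)\<^sup>2"
      using symmetric_projection_pythagoras[OF P, of y]
      unfolding power_mult_distrib a(2) left_diff_distrib by linarith
  qed (use b in simp)
  have "norm (P - Q) \<le> b"
    using norm_projection_diff_le[OF P Q b] on_P on_Q by blast
  moreover have "b \<le> norm (P - Q)"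
    unfolding b_def
  proof (rule norm_blinfun_bound)
    fix x
    \<comment> \<open>\<open>(1 - Q)P = (P - Q)P\<close>, and \<open>P\<close> is a
      contraction.\<close>
    have "norm (((id_blinfun - Q) o\<^sub>L P) x) = norm ((P - Q) (P x))"
      using P by (simp add: blinfun.diff_left symmetric_projection_idem)
    also have "\<dots> \<le> norm (P - Q) * norm (P x)"
      by (rule norm_blinfun)
    also have "\<dots> \<le> norm (P - Q) * norm x"
      using norm_symmetric_projection_le[OF P] by (intro mult_left_mono) auto
    finally show "norm (((id_blinfun - Q) o\<^sub>L P) x) \<le> norm (P - Q) * norm x" .
  qed simp
  ultimately show ?thesis
    using b by (simp add: norm_S)
qed

text \<open>The range of \<open>S\<close> may be smaller than that of \<open>P\<close>, so
  \<open>P\<close> is first replaced by \<open>R\<close>: \<open>S = RQR\<close> still holds, and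
  the lower bound for \<open>S\<close> on its range keeps \<open>Q\<close> bounded below
  there.\<close>

lemma norm_range_projection_minus_PQP_less_1:
  fixes P Q R :: "'a::{real_inner,complete_space} \<Rightarrow>\<^sub>L 'a"
  defines "S \<equiv> P o\<^sub>L Q o\<^sub>L P"
  assumes P: "symmetric_projection P" and Q: "symmetric_projection Q"
    and R: "symmetric_projection R" and range_R: "range (blinfun_apply R) = range (blinfun_apply S)"
    and closed: "closed (range (blinfun_apply S))"
  shows "norm (R - S) < 1"
proof -
  have sym: "inner (S x) y = inner x (S y)" for x y
    using P Q by (simp add: S_def symmetric_projection_sym)
  obtain d0 where d0: "d0 > 0" "\<And>x. x \<in> range (blinfun_apply S) \<Longrightarrow> d0 * norm x \<le> norm (S x)"
    using symmetric_operator_bounded_below_on_closed_range[OF sym closed] by blast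
  \<comment> \<open>The cap at 1 keeps \<open>1 - d\<^sup>2\<close> nonnegative under the square
    root.\<close>
  define d where "d = min d0 1"
  have d: "0 < d" "d \<le> 1"
    using d0 by (auto simp: d_def)
  have below: "d * norm (R x) \<le> norm (S (R x))" for x
  proof -
    have "d * norm (R x) \<le> d0 * norm (R x)"
      by (intro mult_right_mono) (auto simp: d_def)
    also have "\<dots> \<le> norm (S (R x))"
      using range_R by (intro d0(2)) blast
    finally show ?thesis .
  qed
  have PR: "P (R x) = R x" for x
  proof -
    obtain w where "R x = S w"
      using range_R by blast
    then show ?thesis
      using P by (simp add: S_def symmetric_projection_idem)
  qed
  have RS: "R (S x) = S x" for x
    using in_range_symmetric_projection_iff[OF R] range_R by blast
  \<comment> \<open>\<open>RP = R\<close> and, below, \<open>SR = S\<close> are the adjoints of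
    \<open>PR = R\<close> and \<open>RS = S\<close>.\<close>
  have RP: "R (P x) = R x" for x
  proof -
    have "inner (R (P x)) y = inner (R x) y" for y
      by (simp add: symmetric_projection_sym[OF R] symmetric_projection_sym[OF P] PR)
    then show ?thesis
      by (metis vector_eq_rdot)
  qed
  have SR: "S (R x) = S x" for x
  proof -
    have "inner (S (R x)) y = inner (S x) y" for y
      by (simp add: sym symmetric_projection_sym[OF R] RS)
    then show ?thesis
      by (metis vector_eq_rdot)
  qed
  have S_eq: "S = R o\<^sub>L Q o\<^sub>L R"
  proof (rule blinfun_eqI)
    fix x
    have "S x = R (S (R x))"
      by (simp add: RS SR)
    also have "\<dots> = (R o\<^sub>L Q o\<^sub>L R) x"
      by (simp add: S_def PR RP)
    finally show "S x = (R o\<^sub>L Q o\<^sub>L R) x" .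
  qed
  have "norm ((id_blinfun - Q) o\<^sub>L R) \<le> sqrt (1 - d\<^sup>2)"
  proof (rule norm_blinfun_bound)
    fix x
    have "d * norm (R x) \<le> norm (Q (R x))"
      using below[of x] norm_symmetric_projection_le[OF P, of "Q (R x)"] PR by (simp add: S_def)
    then have "(d * norm (R x))\<^sup>2 \<le> (norm (Q (R x)))\<^sup>2"
      using d by (intro power_mono) auto
    then have "(norm (R x - Q (R x)))\<^sup>2 \<le> (1 - d\<^sup>2) * (norm (R x))\<^sup>2"
      using symmetric_projection_pythagoras[OF Q, of "R x"]
      by (simp add: power_mult_distrib algebra_simps)
    also have "\<dots> \<le> (1 - d\<^sup>2) * (norm x)\<^sup>2"
      using d norm_symmetric_projection_le[OF R]
      by (intro mult_left_mono power_mono) (auto simp: power_le_one)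
    also have "\<dots> = (sqrt (1 - d\<^sup>2) * norm x)\<^sup>2"
      using d by (simp add: power_mult_distrib power_le_one)
    finally have "norm (R x - Q (R x)) \<le> sqrt (1 - d\<^sup>2) * norm x"
      by (rule power2_le_imp_le) (use d in \<open>simp add: power_le_one\<close>)
    then show "norm (((id_blinfun - Q) o\<^sub>L R) x) \<le> sqrt (1 - d\<^sup>2) * norm x"
      by (simp add: blinfun.diff_left)
  qed (use d in \<open>simp add: power_le_one\<close>)
  then have "(norm ((id_blinfun - Q) o\<^sub>L R))\<^sup>2 \<le> (sqrt (1 - d\<^sup>2))\<^sup>2"
    by (intro power_mono) auto
  also have "\<dots> < 1"
    using d by (simp add: power_le_one)
  finally show ?thesis
    unfolding S_eq using norm_projection_minus_compression[OF R Q] by simp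
qed

text \<open>For \<open>y\<close> in the range of \<open>P\<close>,
  \<open>inner y (P (Q (P y)))\<close> is the square of \<open>norm (Q y)\<close>. So only vectors
  annihilated by \<open>Q\<close> can be orthogonal to the range of \<open>PQP\<close>, and
  \<open>inj\<close> makes that range dense in the range of \<open>P\<close>.\<close>

lemma range_eq_if_closed_range_PQP:
  fixes P Q :: "'a::{real_inner,complete_space} \<Rightarrow>\<^sub>L 'a"
  assumes P: "symmetric_projection P" and Q: "symmetric_projection Q"
    and inj: "\<And>x. P x = x \<Longrightarrow> Q x = 0 \<Longrightarrow> x = 0"
    and closed: "closed (range (blinfun_apply (P o\<^sub>L Q o\<^sub>L P)))"
  shows "range (blinfun_apply (P o\<^sub>L Q o\<^sub>L P)) = range (blinfun_apply P)"
proof -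
  have "closure (range (blinfun_apply (P o\<^sub>L Q o\<^sub>L P))) = range (blinfun_apply P)"
  proof (rule closure_range_eq_range_projection[OF P])
    fix y
    assume y: "P y = y" and orth: "\<And>x. inner y ((P o\<^sub>L Q o\<^sub>L P) x) = 0"
    have "(norm (Q y))\<^sup>2 = inner y ((P o\<^sub>L Q o\<^sub>L P) y)"
      using norm_symmetric_projection_sq[OF Q, of y] symmetric_projection_sym[OF P, of y "Q y"] y
      by (simp add: inner_commute)
    then have "Q y = 0"
      using orth by simp
    with y show "y = 0"
      by (rule inj)
  qed (simp add: symmetric_projection_idem[OF P])
  then show ?thesis
    using closed by simp
qed

section \<open>Passage to the scalar field\<close>

lemma conjugate_0: "conjugate (0 :: 'k::real_or_complex) = 0"
  using conjugate_add[of "0 :: 'k" 0] by simp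

lemma conjugate_of_real: "conjugate (of_real r :: 'k::real_or_complex) = of_real r"
proof (cases "r = 0")
  case False
  have "(of_real r :: 'k) * conjugate (of_real r) = of_real r * of_real r"
    using mult_conjugate[of "of_real r :: 'k"] by (simp add: scaleR_conv_of_real power2_eq_square)
  with False show ?thesis
    by simp
qed (simp add: conjugate_0)

section \<open>Comparison of \<open>ip\<close> with the real inner product\<close>

context hilbert_space
begin

lemma ip_add_right: "ip x (y + z) = ip x y + ip x z"
  by (metis conjugate_add ip_add_left ip_commute)

lemma ip_diff_left: "ip (x - y) z = ip x z - ip y z"
  using ip_add_left[of "x - y" y z] by simp

lemma ip_diff_right: "ip x (y - z) = ip x y - ip x z"
  using ip_add_right[of x "y - z" z] by simp

lemma ip_zero_left: "ip 0 x = 0"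
  using ip_add_left[of 0 0 x] by simp

lemma ip_eq_0_sym: "ip x y = 0 \<Longrightarrow> ip y x = 0"
  by (metis conjugate_0 ip_commute)

text \<open>Polarization. The sum of both orders stands for twice the real part, as the abstract
  scalar type has no real-part function.\<close>

lemma ip_plus_ip_commute: "ip x y + ip y x = of_real (2 * inner x y)"
proof -
  have "of_real ((norm (x + y))\<^sup>2) = ip x x + ip x y + ip y x + ip y y"
    by (simp only: norm_ip[symmetric] ip_add_left ip_add_right add_ac)
  then have "ip x y + ip y x = of_real ((norm (x + y))\<^sup>2 - (norm x)\<^sup>2 - (norm y)\<^sup>2)"
    by (simp add: norm_ip del: of_real_power)
  also have "(norm (x + y))\<^sup>2 - (norm x)\<^sup>2 - (norm y)\<^sup>2 = 2 * inner x y"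
    by (simp add: power2_norm_eq_inner inner_add_left inner_add_right inner_commute)
  finally show ?thesis .
qed

lemma inner_eq_0_if_ip_eq_0: "ip x y = 0 \<Longrightarrow> inner x y = 0"
  using ip_plus_ip_commute[of x y] ip_eq_0_sym[of x y] by simp

lemma ip_eq_0_if_inner_scale_eq_0:
  assumes "\<And>c. inner (sc c m) x = 0"
  shows "ip m x = 0"
proof -
  \<comment> \<open>This multiplier turns \<open>ip m x\<close> into the real number
    \<open>(norm (ip m x))\<^sup>2\<close>, which the real inner product does detect.\<close>
  define c where "c = conjugate (ip m x)"
  have "ip (sc c m) x = of_real ((norm (ip m x))\<^sup>2)"
    using mult_conjugate[of "ip m x"]
    by (simp add: c_def ip_scale_left mult.commute scaleR_conv_of_real)
  moreover have "ip x (sc c m) = conjugate (ip (sc c m) x)"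
    by (rule ip_commute)
  ultimately have "of_real ((norm (ip m x))\<^sup>2) + of_real ((norm (ip m x))\<^sup>2) = (0 :: 'k)"
    using ip_plus_ip_commute[of "sc c m" x] assms[of c]
    by (simp add: conjugate_of_real del: of_real_power)
  then have "(of_real ((norm (ip m x))\<^sup>2 + (norm (ip m x))\<^sup>2) :: 'k) = 0"
    by (simp only: of_real_add)
  then show ?thesis
    unfolding of_real_eq_0_iff by simp
qed

lemma norm_scale: "norm (sc c x) = norm c * norm x"
proof -
  have "of_real ((norm (sc c x))\<^sup>2) = c * conjugate (c * of_real ((norm x)\<^sup>2))"
    by (metis norm_ip ip_scale_left ip_commute)
  also have "\<dots> = of_real ((norm c * norm x)\<^sup>2)"
  proof (cases "x = 0")
    case False
    \<comment> \<open>Multiplicativity of \<open>conjugate\<close> is not an axiom. The extra factor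
      completes the left side to \<open>z * conjugate z\<close> with
      \<open>z = c * of_real ((norm x)\<^sup>2)\<close>, and is cancelled afterwards.\<close>
    have "of_real ((norm x)\<^sup>2) * (c * conjugate (c * of_real ((norm x)\<^sup>2)))
        = of_real ((norm x)\<^sup>2) * of_real ((norm c * norm x)\<^sup>2)"
      using mult_conjugate[of "c * of_real ((norm x)\<^sup>2)"]
      by (simp add: scaleR_conv_of_real norm_mult norm_power power_mult_distrib power2_eq_square
          mult_ac)
    with False show ?thesis
      by (simp del: of_real_power of_real_mult)
  qed (simp add: conjugate_0)
  finally show ?thesis
    by (simp only: of_real_eq_iff) (simp add: power2_eq_iff_nonneg)
qed

section \<open>Subspaces and projections over the scalar field\<close>

lemma subspace_imp_real_subspace: "subspace M \<Longrightarrow> Real_Vector_Spaces.subspace M"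
  unfolding Real_Vector_Spaces.subspace_def using subspace_0 subspace_add subspace_scale
  by (metis scale_of_real)

lemma subspace_range_bounded_operator:
  assumes "T \<in> bounded_operators sc"
  shows "subspace (range (blinfun_apply T))"
  using assms
  by (auto simp: bounded_operators_def linear_iff_module_hom intro!: module_hom.subspace_image)

lemma bounded_linear_scale: "bounded_linear (sc c)"
  by (intro bounded_linear_intro[where K = "norm c"])
    (simp_all add: scale_right_distrib norm_scale mult.commute,
     metis scale_of_real scale_left_commute)

lemma scalar_subspace_closure:
  assumes "subspace M"
  shows "subspace (closure M)"
proof (rule subspaceI)
  have real: "Real_Vector_Spaces.subspace (closure M)"
    using assms by (intro subspace_closure subspace_imp_real_subspace)
  show "0 \<in> closure M"
    using real by (rule Real_Vector_Spaces.subspace_0)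
  show "x + y \<in> closure M" if "x \<in> closure M" "y \<in> closure M" for x y
    using real that by (rule Real_Vector_Spaces.subspace_add)
  show "sc c x \<in> closure M" if x: "x \<in> closure M" for c x
  proof -
    obtain f where f: "\<And>n. f n \<in> M" "f \<longlonglongrightarrow> x"
      using x unfolding closure_sequential by blast
    have "\<forall>n. sc c (f n) \<in> M"
      using f(1) assms subspace_scale by blast
    moreover have "(\<lambda>n. sc c (f n)) \<longlonglongrightarrow> sc c x"
      by (rule bounded_linear.tendsto[OF bounded_linear_scale f(2)])
    ultimately show ?thesis
      unfolding closure_sequential by (intro exI[of _ "\<lambda>n. sc c (f n)"] conjI)
  qed
qed

lemma orth_projection_imp_symmetric_projection:
  assumes "orth_projection sc ip P"
  shows "symmetric_projection P"
proof -
  have P: "P o\<^sub>L P = P" "\<And>x y. ip (P x) y = ip x (P y)"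
    using assms by (auto simp: orth_projection_def)
  have "(of_real (2 * inner (P x) y) :: 'k) = of_real (2 * inner x (P y))" for x y
    unfolding ip_plus_ip_commute[symmetric] P(2) by (simp add: P(2)[symmetric])
  then have "inner (P x) y = inner x (P y)" for x y
    unfolding of_real_eq_iff by simp
  moreover have "P (P x) = P x" for x
    using P(1) by (metis blinfun_apply_blinfun_compose)
  ultimately show ?thesis
    by (simp add: symmetric_projection_def)
qed

lemma orth_projection_ip: "orth_projection sc ip P \<Longrightarrow> ip (P x) y = ip x (P y)"
  by (simp add: orth_projection_def)

text \<open>Since the range admits all scalars, real orthogonality of \<open>x - P x\<close> to it
  upgrades to \<open>ip\<close>-orthogonality, which yields symmetry for \<open>ip\<close> and then
  linearity over the scalars.\<close>

lemma symmetric_projection_imp_orth_projection: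
  assumes P: "symmetric_projection P" and sub: "subspace (range (blinfun_apply P))"
  shows "orth_projection sc ip P"
proof -
  have fix_iff: "x \<in> range (blinfun_apply P) \<longleftrightarrow> P x = x" for x
    by (rule in_range_symmetric_projection_iff[OF P])
  have orth: "ip m (x - P x) = 0" if "m \<in> range (blinfun_apply P)" for m x
  proof (rule ip_eq_0_if_inner_scale_eq_0)
    fix c
    have "P (sc c m) = sc c m"
      using that subspace_scale[OF sub] fix_iff by blast
    then show "inner (sc c m) (x - P x) = 0"
      using symmetric_projection_sym[OF P, of "sc c m" x] by (simp add: inner_diff_right)
  qed
  have sym: "ip (P x) y = ip x (P y)" for x y
  proof -
    have "ip (P x) y = ip (P x) (P y)"
      using orth[of "P x" y] by (simp add: ip_diff_right)
    moreover have "ip (x - P x) (P y) = 0"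
      using orth[of "P y" x] ip_eq_0_sym by blast
    ultimately show ?thesis
      by (simp add: ip_diff_left)
  qed
  have "P (sc c x) = sc c (P x)" for c x
  proof -
    \<comment> \<open>The defect \<open>v\<close> of homogeneity lies in the range of
      \<open>P\<close>, while \<open>ip v v\<close> reduces to a multiple of
      \<open>ip (x - P x) v\<close>, which is zero.\<close>
    define v where "v = P (sc c x) - sc c (P x)"
    have "v \<in> range (blinfun_apply P)"
      unfolding v_def by (intro subspace_diff[OF sub] subspace_scale[OF sub]) auto
    then have Pv: "P v = v"
      using fix_iff by blast
    have "ip v v = c * ip (x - P x) v"
      unfolding v_def[THEN arg_cong, of "\<lambda>u. ip u v"]
      by (simp add: ip_diff_left sym Pv ip_scale_left algebra_simps)
    also have "\<dots> = 0"
      by (simp add: ip_diff_left sym Pv)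
    finally show ?thesis
      by (simp add: norm_ip v_def)
  qed
  then have "P \<in> bounded_operators sc"
    unfolding bounded_operators_def
    by (auto intro!: Vector_Spaces.linear.intro module_hom.intro vector_space_axioms module_axioms
        simp: module_hom_axioms_def blinfun.add_right)
  moreover have "P o\<^sub>L P = P"
    using P by (intro blinfun_eqI) (simp add: symmetric_projection_idem)
  ultimately show ?thesis
    using sym by (simp add: orth_projection_def)
qed

text \<open>Evaluates the definite description in \<open>proj_onto\<close>: a projection is
  determined by its range.\<close>

lemma proj_onto_range:
  assumes "orth_projection sc ip P"
  shows "proj_onto sc ip (range (blinfun_apply P)) = P"
  unfolding proj_onto_def
  using assms symmetric_projection_eqI orth_projection_imp_symmetric_projection
  by (intro the_equality) auto

lemma proj_onto_closed_subspace:
  assumes "subspace M" "closed M"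
  shows orth_projection_proj_onto: "orth_projection sc ip (proj_onto sc ip M)"
    and range_proj_onto: "range (blinfun_apply (proj_onto sc ip M)) = M"
proof -
  obtain P where P: "symmetric_projection P" "range (blinfun_apply P) = M"
    using symmetric_projection_onto_exists[OF subspace_imp_real_subspace] assms by blast
  then have "orth_projection sc ip P"
    using assms symmetric_projection_imp_orth_projection by blast
  moreover from this have "proj_onto sc ip M = P"
    using proj_onto_range P(2) by blast
  ultimately show "orth_projection sc ip (proj_onto sc ip M)"
    and "range (blinfun_apply (proj_onto sc ip M)) = M"
    using P(2) by simp_all
qed

lemma subspace_orth_compl: "subspace (orth_compl ip M)"
  by (rule subspaceI) (auto simp: orth_compl_def ip_zero_left ip_add_left ip_scale_left)

lemma subspace_nullspace:
  assumes "T \<in> bounded_operators sc"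
  shows "subspace (nullspace T)"
  using assms by (auto intro!: subspaceI simp: nullspace_def bounded_operators_def
      blinfun.add_right linear_iff_module_hom module_hom.scale)

lemma closed_orth_compl:
  assumes "subspace M"
  shows "closed (orth_compl ip M)"
proof -
  \<comment> \<open>Expresses the complement through the real inner product with all multiples of
    \<open>m\<close>, so that continuity of \<open>inner\<close> gives closedness.\<close>
  have "ip x m = 0 \<longleftrightarrow> (\<forall>c. inner x (sc c m) = 0)" for x m
  proof
    assume "ip x m = 0"
    then have "ip (sc c m) x = 0" for c
      by (simp add: ip_scale_left ip_eq_0_sym)
    then show "\<forall>c. inner x (sc c m) = 0"
      by (metis inner_commute inner_eq_0_if_ip_eq_0)
  next
    assume "\<forall>c. inner x (sc c m) = 0"
    then show "ip x m = 0"
      by (metis inner_commute ip_eq_0_if_inner_scale_eq_0 ip_eq_0_sym)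
  qed
  then have "orth_compl ip M = (\<Inter>m\<in>M. \<Inter>c. {x. inner x (sc c m) = 0})"
    by (auto simp: orth_compl_def)
  moreover have "closed {x. inner x y = 0}" for y :: 'a
    by (intro closed_Collect_eq continuous_intros)
  ultimately show ?thesis
    by (simp only:) (intro closed_INT ballI)
qed

lemma orth_compl_nullspace_orth_projection:
  assumes "orth_projection sc ip Q"
  shows "orth_compl ip (nullspace Q) = range (blinfun_apply Q)"
proof (intro subset_antisym subsetI)
  have Q: "symmetric_projection Q"
    by (rule orth_projection_imp_symmetric_projection[OF assms])
  fix x
  show "x \<in> orth_compl ip (nullspace Q)" if "x \<in> range (blinfun_apply Q)"
  proof -
    obtain w where "x = Q w"
      using \<open>x \<in> range (blinfun_apply Q)\<close> by blast
    then show ?thesis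
      using ip_eq_0_sym[OF ip_zero_left]
      by (simp add: orth_compl_def nullspace_def orth_projection_ip[OF assms])
  qed
  show "x \<in> range (blinfun_apply Q)" if "x \<in> orth_compl ip (nullspace Q)"
  proof -
    \<comment> \<open>\<open>x - Q x\<close> lies in the nullspace, hence is orthogonal to
      \<open>x\<close>; it is orthogonal to \<open>Q x\<close> as well, and therefore to
      itself.\<close>
    have "Q (x - Q x) = 0"
      using Q by (simp add: blinfun.diff_right symmetric_projection_idem)
    moreover from this have "ip x (x - Q x) = 0"
      using that by (simp add: orth_compl_def nullspace_def)
    ultimately have "inner (x - Q x) (x - Q x) = 0"
      using inner_eq_0_if_ip_eq_0[of x "x - Q x"] symmetric_projection_sym[OF Q, of x "x - Q x"]
      by (simp add: inner_diff_left)
    then have "Q x = x"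
      by simp
    then show ?thesis
      by (metis rangeI)
  qed
qed

section \<open>Canonical factorizations and trivial intersections\<close>

lemma bounded_operators_compose:
  "T \<in> bounded_operators sc \<Longrightarrow> U \<in> bounded_operators sc \<Longrightarrow> T o\<^sub>L U \<in> bounded_operators sc"
  unfolding bounded_operators_def mem_Collect_eq blinfun_compose.rep_eq
  by (rule Vector_Spaces.linear_compose)

text \<open>The two conditions decouple: the one on \<open>P\<close> excludes nonzero vectors fixed
  by \<open>P\<close> and killed by \<open>Q\<close>, the one on \<open>Q\<close> those fixed by
  \<open>Q\<close> and killed by \<open>P\<close>.\<close>

lemma canonical_factorization_iff:
  fixes P Q :: "'a \<Rightarrow>\<^sub>L 'a"
  assumes P: "orth_projection sc ip P" and Q: "orth_projection sc ip Q"
  shows "canonical_factorization sc ip (P o\<^sub>L Q) P Q \<longleftrightarrow>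
    (\<forall>x. P x = x \<longrightarrow> Q x = 0 \<longrightarrow> x = 0) \<and> (\<forall>y. Q y = y \<longrightarrow> P y = 0 \<longrightarrow> y = 0)"
    (is "_ \<longleftrightarrow> ?R")
proof -
  let ?T = "P o\<^sub>L Q"
  let ?C = "closure (range (blinfun_apply ?T))"
  let ?N = "orth_compl ip (nullspace ?T)"
  have sP: "symmetric_projection P" and sQ: "symmetric_projection Q"
    using P Q by (auto intro: orth_projection_imp_symmetric_projection)
  have T: "?T \<in> bounded_operators sc"
    using P Q by (auto simp: orth_projection_def intro: bounded_operators_compose)
  have P_iff: "P = proj_onto sc ip ?C \<longleftrightarrow> ?C = range (blinfun_apply P)"
    using proj_onto_range[OF P]
      range_proj_onto[OF scalar_subspace_closure[OF subspace_range_bounded_operator[OF T]] closed_closure]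
    by metis
  have Q_iff: "Q = proj_onto sc ip ?N \<longleftrightarrow> ?N = range (blinfun_apply Q)"
    using proj_onto_range[OF Q]
      range_proj_onto[OF subspace_orth_compl closed_orth_compl[OF subspace_nullspace[OF T]]]
    by metis
  have C_eq: "?C = range (blinfun_apply P)" if "\<forall>x. P x = x \<longrightarrow> Q x = 0 \<longrightarrow> x = 0"
  proof (rule closure_range_eq_range_projection[OF sP])
    fix y
    assume y: "P y = y" and orth: "\<And>x. inner y (?T x) = 0"
    have "inner (Q y) (Q y) = inner y (?T y)"
      using symmetric_projection_sym[OF sQ] symmetric_projection_sym[OF sP, of y "Q y"] y
        symmetric_projection_idem[OF sQ] by simp
    then have "Q y = 0"
      using orth by simp
    with y that show "y = 0"
      by blast
  qed (simp add: symmetric_projection_idem[OF sP])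
  have inj_P: "x = 0" if C: "?C = range (blinfun_apply P)" and x: "P x = x" "Q x = 0" for x
  proof -
    \<comment> \<open>Such an \<open>x\<close> is orthogonal to the range of \<open>PQ\<close>,
      hence to its closure, which contains \<open>x\<close>.\<close>
    have "inner x (?T z) = 0" for z
      by (simp add: symmetric_projection_sym[OF sP, symmetric]
          symmetric_projection_sym[OF sQ, symmetric] x)
    then have "range (blinfun_apply ?T) \<subseteq> {z. inner x z = 0}"
      by blast
    moreover have "closed {z. inner x z = 0}"
      by (intro closed_Collect_eq continuous_intros)
    ultimately have "?C \<subseteq> {z. inner x z = 0}"
      by (rule closure_minimal)
    moreover have "x \<in> ?C"
      unfolding C using x by (metis rangeI)
    ultimately show "x = 0"
      by auto
  qed
  have N_eq: "?N = range (blinfun_apply Q)" if "\<forall>y. Q y = y \<longrightarrow> P y = 0 \<longrightarrow> y = 0"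
  proof -
    \<comment> \<open>\<open>P (Q x) = 0\<close> puts \<open>Q x\<close> in both the range of
      \<open>Q\<close> and the nullspace of \<open>P\<close>, so \<open>Q x = 0\<close>.\<close>
    have "nullspace ?T = nullspace Q"
      using that symmetric_projection_idem[OF sQ] by (auto simp: nullspace_def)
    then show ?thesis
      using orth_compl_nullspace_orth_projection[OF Q] by simp
  qed
  have inj_Q: "y = 0" if N: "?N = range (blinfun_apply Q)" and y: "Q y = y" "P y = 0" for y
  proof -
    have "y \<in> ?N"
      unfolding N using y by (metis rangeI)
    moreover have "y \<in> nullspace ?T"
      using y by (simp add: nullspace_def)
    ultimately have "ip y y = 0"
      by (simp add: orth_compl_def)
    then show "y = 0"
      by (simp add: norm_ip)
  qed
  have "P = proj_onto sc ip ?C \<longleftrightarrow> (\<forall>x. P x = x \<longrightarrow> Q x = 0 \<longrightarrow> x = 0)"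
    unfolding P_iff using C_eq inj_P by blast
  moreover have "Q = proj_onto sc ip ?N \<longleftrightarrow> (\<forall>y. Q y = y \<longrightarrow> P y = 0 \<longrightarrow> y = 0)"
    unfolding Q_iff using N_eq inj_Q by blast
  ultimately show ?thesis
    by (simp only: canonical_factorization_def simp_thms)
qed

end

theorem theorem4p2:
  fixes sc :: "'k::real_or_complex \<Rightarrow> 'a::{real_inner,complete_space} \<Rightarrow> 'a"
    and ip :: "'a \<Rightarrow> 'a \<Rightarrow> 'k"
    and S :: "'a \<Rightarrow>\<^sub>L 'a"
  assumes "hilbert_space sc ip"
    and "S \<in> PQP_operators sc ip"
  shows "(\<not> closed (range (blinfun_apply S)) \<longrightarrow>
            (\<forall>(P, Q) \<in> PQP_pairs sc ip S. norm (P - Q) = 1)) \<and>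
         (closed (range (blinfun_apply S)) \<longrightarrow>
            (\<exists>c<1. c = sqrt (norm (proj_onto sc ip (range (blinfun_apply S)) - S)) \<and>
              (\<forall>(P, Q) \<in> PQP_pairs sc ip S. \<forall>T. T = P o\<^sub>L Q \<longrightarrow>
                 (\<not> canonical_factorization sc ip T P Q \<and> norm (P - Q) = 1) \<or>
                 (closed (range (blinfun_apply T)) \<and>
                  P = proj_onto sc ip (range (blinfun_apply T)) \<and>
                  Q = proj_onto sc ip (orth_compl ip (nullspace T)) \<and>
                  norm (proj_onto sc ip (range (blinfun_apply T)) -
                        proj_onto sc ip (orth_compl ip (nullspace T))) = c))))"
proof -
  interpret hilbert_space sc ip
    by (rule assms(1))
  let ?R = "range (blinfun_apply S)"
  let ?PS = "proj_onto sc ip ?R"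
  have not_closed: "norm (P - Q) = 1"
    if "\<not> closed ?R" "(P, Q) \<in> PQP_pairs sc ip S" for P Q
  proof (rule ccontr)
    have P: "symmetric_projection P" and Q: "symmetric_projection Q" and S: "S = P o\<^sub>L Q o\<^sub>L P"
      using that(2) by (auto simp: PQP_pairs_def intro: orth_projection_imp_symmetric_projection)
    assume "norm (P - Q) \<noteq> 1"
    then have "norm (P - Q) < 1"
      using norm_projection_diff_le_1[OF P Q] by simp
    then have "?R = range (blinfun_apply P)"
      unfolding S by (rule range_PQP_if_norm_diff_less_1[OF P Q])
    also have "\<dots> = {x. P x = x}"
      using in_range_symmetric_projection_iff[OF P] by blast
    finally have "closed ?R"
      by (simp add: closed_Collect_eq continuous_intros)
    with that(1) show False
      by blast
  qed
  \<comment> \<open>The constant depends on \<open>S\<close> alone, so any pair representing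
    \<open>S\<close> serves; it need not be canonical.\<close>
  have less: "norm (?PS - S) < 1" if closed: "closed ?R"
  proof -
    obtain P Q where PQ: "orth_projection sc ip P" "orth_projection sc ip Q" "S = P o\<^sub>L Q o\<^sub>L P"
      using assms(2) by (auto simp: PQP_operators_def)
    then have "S \<in> bounded_operators sc"
      by (auto simp: orth_projection_def intro: bounded_operators_compose)
    then have "subspace ?R"
      by (rule subspace_range_bounded_operator)
    then have "symmetric_projection ?PS" "range (blinfun_apply ?PS) = ?R"
      using closed
      by (auto simp: range_proj_onto
          intro!: orth_projection_imp_symmetric_projection orth_projection_proj_onto)
    with PQ closed show ?thesis
      by (metis norm_range_projection_minus_PQP_less_1 orth_projection_imp_symmetric_projection)
  qed
  have alternative: "(\<not> canonical_factorization sc ip (P o\<^sub>L Q) P Q \<and> norm (P - Q) = 1) \<or>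
      (closed (range (blinfun_apply (P o\<^sub>L Q))) \<and>
       P = proj_onto sc ip (range (blinfun_apply (P o\<^sub>L Q))) \<and>
       Q = proj_onto sc ip (orth_compl ip (nullspace (P o\<^sub>L Q))) \<and>
       norm (P - Q) = sqrt (norm (?PS - S)))"
    if closed: "closed ?R" and PQ: "(P, Q) \<in> PQP_pairs sc ip S" for P Q
  proof -
    have oP: "orth_projection sc ip P" and oQ: "orth_projection sc ip Q"
      and S: "S = P o\<^sub>L Q o\<^sub>L P"
      using PQ by (auto simp: PQP_pairs_def)
    then have P: "symmetric_projection P" and Q: "symmetric_projection Q"
      by (auto intro: orth_projection_imp_symmetric_projection)
    show ?thesis
    proof (cases "canonical_factorization sc ip (P o\<^sub>L Q) P Q")
      case True
      then have inj_P: "P x = x \<Longrightarrow> Q x = 0 \<Longrightarrow> x = 0"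
        and inj_Q: "Q x = x \<Longrightarrow> P x = 0 \<Longrightarrow> x = 0" for x
        using canonical_factorization_iff[OF oP oQ] by blast+
      have R: "?R = range (blinfun_apply P)"
        using range_eq_if_closed_range_PQP[OF P Q inj_P] closed S by blast
      then have PS: "?PS = P"
        using proj_onto_range[OF oP] by simp
      \<comment> \<open>The range of \<open>PQ\<close> is squeezed between those of
        \<open>PQP\<close> and \<open>P\<close>, which agree here; so it is closed and the closure
        in the canonical form disappears.\<close>
      have "?R \<subseteq> range (blinfun_apply (P o\<^sub>L Q))"
        unfolding S by auto
      then have range_T: "range (blinfun_apply (P o\<^sub>L Q)) = ?R"
        unfolding R by auto
      have "norm (P - Q) = sqrt (norm (?PS - S))"
      proof -
        have "norm (P - S) < 1"
          using less[OF closed] PS by simp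
        then show ?thesis
          using norm_projection_diff_eq[OF P Q] inj_Q PS S by simp
      qed
      moreover have "Q = proj_onto sc ip (orth_compl ip (nullspace (P o\<^sub>L Q)))"
        using True unfolding canonical_factorization_def by blast
      ultimately show ?thesis
        unfolding range_T using closed PS by blast
    next
      case False
      \<comment> \<open>Either kind of vector is moved by \<open>P - Q\<close> without loss of norm;
        the second kind uses the roles of \<open>P\<close> and \<open>Q\<close> exchanged.\<close>
      then consider x where "P x = x" "Q x = 0" "x \<noteq> 0" | x where "Q x = x" "P x = 0" "x \<noteq> 0"
        using canonical_factorization_iff[OF oP oQ] by blast
      then have "norm (P - Q) = 1"
        using norm_projection_diff_eq_1[OF P Q] norm_projection_diff_eq_1[OF Q P]
        by cases (auto simp: norm_minus_commute)
      with False show ?thesis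
        by blast
    qed
  qed
  show ?thesis
  proof (intro conjI impI exI[of _ "sqrt (norm (?PS - S))"] refl)
    show "\<forall>(P, Q) \<in> PQP_pairs sc ip S. norm (P - Q) = 1" if "\<not> closed ?R"
      using not_closed[OF that] by blast
    assume closed: "closed ?R"
    show "sqrt (norm (?PS - S)) < 1"
      using less[OF closed] by simp
    show "\<forall>(P, Q) \<in> PQP_pairs sc ip S. \<forall>T. T = P o\<^sub>L Q \<longrightarrow>
        (\<not> canonical_factorization sc ip T P Q \<and> norm (P - Q) = 1) \<or>
        (closed (range (blinfun_apply T)) \<and>
         P = proj_onto sc ip (range (blinfun_apply T)) \<and>
         Q = proj_onto sc ip (orth_compl ip (nullspace T)) \<and>
         norm (proj_onto sc ip (range (blinfun_apply T)) -
               proj_onto sc ip (orth_compl ip (nullspace T))) = sqrt (norm (?PS - S)))"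
      using alternative[OF closed] by fastforce
  qed
qed

end
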